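(* Consider a connected power network with nodes $i=1,\dots,I$, demands $D_i\ge0$, and generators $n=1,\dots,N$ with cost functions $c_n$. Assume that the feasible dispatch set remains non-empty if any one of the generators is excluded, i.e. for each generator $n_0$ there is a feasible point of the economic dispatch problem with $x_{n_0}=0$. Then there exists an efficient Nash equilibrium in the Power Network Second Price (PNSP) mechanism.
   Context: Network: a connected power network with nodes $i=1,\dots,I$; line $i$-$j$ has admittance $Y_{ij}=Y_{ji}>0$ ($Y_{ij}=0$ if there is no line) and capacity $C_{ij}=C_{ji}>0$. There are generators $n=1,\dots,N$; $\mathcal N_i$ is the set of generators at node $i$; generator $n$ has cost function $c_n:\mathbb R_+\to\mathbb R_+$ with $c_n(0)=0$, $c_n'\ge 0$, $c_n''\ge 0$. Node $i$ has inelastic demand $D_i\ge 0$. Economic dispatch problem: minimize $\sum_n c_n(x_n)$ over $x_n,\theta_i\in\mathbb R$ subject to $\sum_{n\in\mathcal N_i}x_n-D_i=\sum_jY_{ij}(\theta_i-\theta_j)$ for all $i$; $Y_{ij}(\theta_i-\theta_j)\le C_{ij}$ for all ordered pairs $(i,j)$ joined by a line; $x_n\ge0$ for all $n$. PNSP mechanism. Each generator $n$ submits a bid $(p_n,s_n,q_n)$ with $0\le p_n\le q_n$, $s_n\ge0$, identified with the function $b_n(x_n)=p_nx_n$ for $x_n\le s_n$ and $b_n(x_n)=q_nx_n+(p_n-q_n)s_n$ for $x_n>s_n$. Given the bid profile $b=(b_1,\dots,b_N)$, the dispatch $x=(x_1,\dots,x_N)$ is (the $x$-part of) an optimal solution of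 the economic dispatch problem with each $c_n$ replaced by $b_n$; if the optimal $x$ is not unique, any optimal $x$ may be the dispatch associated with $b$. For each $n_0$, let $x^{-n_0}=(x_1^{-n_0},\dots,x_N^{-n_0})$ be an optimal solution of the same problem (with the bids $b_n$) when generator $n_0$ is excluded, i.e. with the additional constraint $x_{n_0}=0$. The payment made to generator $n_0$ is $w_{n_0}=\sum_{n\ne n_0}b_n(x_n^{-n_0})-\sum_{n\ne n_0}b_n(x_n)$, and his payoff is $u_{n_0}=w_{n_0}-c_{n_0}(x_{n_0})$. A (pure) Nash equilibrium is a bid profile $b$ together with an associated dispatch $x$ such that no generator can be strictly better off by a unilateral change of his bid (for no generator $n$ and no alternative bid of $n$ does a dispatch associated with the changed profile give $n$ a strictly larger payoff). It is efficient if $x$ also solves the economic dispatch problem (with the true costs $c_n$). *)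

theory Defs
  imports "HOL-Analysis.Analysis"
begin

text \<open>
  Nodes and generators are indexed by the finite types \<open>'i\<close> and \<open>'n\<close>. An admittance of 0 means
  that there is no line; capacities are only meaningful on lines. \<open>location G n\<close> is the node of
  generator \<open>n\<close>, so the set of generators at node \<open>i\<close> is \<open>{n. location G n = i}\<close>.
\<close>

record ('i, 'n) power_network =
  admittance :: "'i \<Rightarrow> 'i \<Rightarrow> real"
  capacity :: "'i \<Rightarrow> 'i \<Rightarrow> real"
  demand :: "'i \<Rightarrow> real"
  location :: "'n \<Rightarrow> 'i"

definition lines :: "('i, 'n) power_network \<Rightarrow> ('i \<times> 'i) set" where
  "lines G = {(i, j). admittance G i j \<noteq> 0}"

definition connected_power_network :: "('i, 'n) power_network \<Rightarrow> bool" where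
  "connected_power_network G \<longleftrightarrow>
     (\<forall>i j. admittance G i j \<ge> 0 \<and> admittance G i j = admittance G j i) \<and>
     (\<forall>(i, j) \<in> lines G. capacity G i j > 0 \<and> capacity G i j = capacity G j i) \<and>
     (\<forall>i. demand G i \<ge> 0) \<and>
     (\<forall>i j. (i, j) \<in> (lines G)\<^sup>*)"

text \<open>
  The derivatives are taken on the half-line, hence one-sided at 0; values of the cost function
  at negative arguments are irrelevant.
\<close>

definition cost_function :: "(real \<Rightarrow> real) \<Rightarrow> bool" where
  "cost_function f \<longleftrightarrow>
     f 0 = 0 \<and> (\<forall>x\<ge>0. f x \<ge> 0) \<and>
     (\<exists>f' f''. \<forall>x\<ge>0.
        (f has_real_derivative f' x) (at x within {0..}) \<and>
        (f' has_real_derivative f'' x) (at x within {0..}) \<and>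
        f' x \<ge> 0 \<and> f'' x \<ge> 0)"

definition feasible_point ::
    "('i::finite, 'n::finite) power_network \<Rightarrow> real ^ 'n \<Rightarrow> real ^ 'i \<Rightarrow> bool" where
  "feasible_point G x \<theta> \<longleftrightarrow>
     (\<forall>i. (\<Sum>n | location G n = i. x $ n) - demand G i =
          (\<Sum>j\<in>UNIV. admittance G i j * (\<theta> $ i - \<theta> $ j))) \<and>
     (\<forall>(i, j) \<in> lines G. admittance G i j * (\<theta> $ i - \<theta> $ j) \<le> capacity G i j) \<and>
     (\<forall>n. x $ n \<ge> 0)"

definition feasible_dispatch ::
    "('i::finite, 'n::finite) power_network \<Rightarrow> real ^ 'n \<Rightarrow> bool" where
  "feasible_dispatch G x \<longleftrightarrow> (\<exists>\<theta>. feasible_point G x \<theta>)"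

definition total_cost :: "('n::finite \<Rightarrow> real \<Rightarrow> real) \<Rightarrow> real ^ 'n \<Rightarrow> real" where
  "total_cost f x = (\<Sum>n\<in>UNIV. f n (x $ n))"

text \<open>
  The objective does not involve the voltage angles, so \<open>x\<close> is the dispatch part of an optimal
  point iff it minimizes the total cost over the projection of the feasible set.
\<close>

definition economic_dispatch ::
    "('i::finite, 'n::finite) power_network \<Rightarrow> ('n \<Rightarrow> real \<Rightarrow> real) \<Rightarrow> real ^ 'n \<Rightarrow> bool" where
  "economic_dispatch G f x \<longleftrightarrow> is_arg_min (total_cost f) (feasible_dispatch G) x"

definition economic_dispatch_excluding ::
    "('i::finite, 'n::finite) power_network \<Rightarrow> 'n \<Rightarrow> ('n \<Rightarrow> real \<Rightarrow> real) \<Rightarrow> real ^ 'n \<Rightarrow> bool" where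
  "economic_dispatch_excluding G m f x \<longleftrightarrow>
     is_arg_min (total_cost f) (\<lambda>y. feasible_dispatch G y \<and> y $ m = 0) x"

text \<open>A bid is a triple \<open>(p, s, q)\<close>: marginal price \<open>p\<close> up to quantity \<open>s\<close> and \<open>q\<close> beyond it.\<close>

type_synonym bid = "real \<times> real \<times> real"

definition valid_bid :: "bid \<Rightarrow> bool" where
  "valid_bid = (\<lambda>(p, s, q). 0 \<le> p \<and> p \<le> q \<and> 0 \<le> s)"

definition bid_fun :: "bid \<Rightarrow> real \<Rightarrow> real" where
  "bid_fun = (\<lambda>(p, s, q) x. if x \<le> s then p * x else q * x + (p - q) * s)"

definition pnsp_dispatch ::
    "('i::finite, 'n::finite) power_network \<Rightarrow> ('n \<Rightarrow> bid) \<Rightarrow> real ^ 'n \<Rightarrow> bool" where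
  "pnsp_dispatch G b x \<longleftrightarrow> economic_dispatch G (\<lambda>n. bid_fun (b n)) x"

text \<open>
  Only the value \<open>\<Sum>n \<noteq> m. b n (x n)\<close> of the following solution enters the payment, and this value
  does not depend on which solution is chosen, see \<open>excluded_value_unique\<close>.
\<close>

definition excluded_dispatch ::
    "('i::finite, 'n::finite) power_network \<Rightarrow> ('n \<Rightarrow> bid) \<Rightarrow> 'n \<Rightarrow> real ^ 'n" where
  "excluded_dispatch G b m =
     (SOME y. economic_dispatch_excluding G m (\<lambda>n. bid_fun (b n)) y)"

definition payment ::
    "('i::finite, 'n::finite) power_network \<Rightarrow> ('n \<Rightarrow> bid) \<Rightarrow> real ^ 'n \<Rightarrow> 'n \<Rightarrow> real" where
  "payment G b x m =
     (\<Sum>n\<in>UNIV - {m}. bid_fun (b n) (excluded_dispatch G b m $ n)) -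
     (\<Sum>n\<in>UNIV - {m}. bid_fun (b n) (x $ n))"

definition payoff ::
    "('i::finite, 'n::finite) power_network \<Rightarrow> ('n \<Rightarrow> real \<Rightarrow> real) \<Rightarrow>
      ('n \<Rightarrow> bid) \<Rightarrow> real ^ 'n \<Rightarrow> 'n \<Rightarrow> real" where
  "payoff G c b x m = payment G b x m - c m (x $ m)"

text \<open>A deviation must be unprofitable for every dispatch associated with the changed profile.\<close>

definition nash_equilibrium ::
    "('i::finite, 'n::finite) power_network \<Rightarrow> ('n \<Rightarrow> real \<Rightarrow> real) \<Rightarrow>
      ('n \<Rightarrow> bid) \<Rightarrow> real ^ 'n \<Rightarrow> bool" where
  "nash_equilibrium G c b x \<longleftrightarrow>
     (\<forall>n. valid_bid (b n)) \<and> pnsp_dispatch G b x \<and>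
     (\<forall>m \<beta> x'. valid_bid \<beta> \<longrightarrow> pnsp_dispatch G (b(m := \<beta>)) x' \<longrightarrow>
        payoff G c (b(m := \<beta>)) x' m \<le> payoff G c b x m)"

definition efficient_nash_equilibrium ::
    "('i::finite, 'n::finite) power_network \<Rightarrow> ('n \<Rightarrow> real \<Rightarrow> real) \<Rightarrow>
      ('n \<Rightarrow> bid) \<Rightarrow> real ^ 'n \<Rightarrow> bool" where
  "efficient_nash_equilibrium G c b x \<longleftrightarrow> nash_equilibrium G c b x \<and> economic_dispatch G c x"

lemma bid_fun_0: "valid_bid \<beta> \<Longrightarrow> bid_fun \<beta> 0 = 0"
  by (auto simp: valid_bid_def bid_fun_def)

lemma excluded_value_unique:
  assumes "valid_bid (b m)"
    and "economic_dispatch_excluding G m (\<lambda>n. bid_fun (b n)) y"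
    and "economic_dispatch_excluding G m (\<lambda>n. bid_fun (b n)) z"
  shows "(\<Sum>n\<in>UNIV - {m}. bid_fun (b n) (y $ n)) = (\<Sum>n\<in>UNIV - {m}. bid_fun (b n) (z $ n))"
proof -
  have tot: "total_cost (\<lambda>n. bid_fun (b n)) v = (\<Sum>n\<in>UNIV - {m}. bid_fun (b n) (v $ n))"
    if "v $ m = 0" for v
    unfolding total_cost_def using that assms(1) by (simp add: sum.remove[of UNIV m] bid_fun_0)
  have "y $ m = 0" "z $ m = 0"
    and "total_cost (\<lambda>n. bid_fun (b n)) y = total_cost (\<lambda>n. bid_fun (b n)) z"
    using assms(2,3) unfolding economic_dispatch_excluding_def is_arg_min_def
    by (auto simp: not_less intro: antisym)
  then show ?thesis by (simp add: tot)
qed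

end

(* At an optimal dispatch x of the true problem, let every generator n bid the linear function with
   slope c_n'(x_n). The first-order condition says that x also minimizes the bid costs, and by
   convexity c_m lies above its tangent, so x still minimizes the cost when the bid of a single
   generator m is replaced by his true cost. The payoff of m is a constant that does not depend on
   his bid minus exactly this cost, so no deviation pays. *)

theory Submission
  imports Defs
begin

section \<open>Convex cost functions on the half-line\<close>

lemma mvt_half_line:
  fixes f :: "real \<Rightarrow> real"
  assumes "\<And>x. x \<ge> 0 \<Longrightarrow> (f has_real_derivative f' x) (at x within {0..})"
    and "0 \<le> a" "a < b"
  obtains z where "a < z" "z < b" "f b - f a = f' z * (b - a)"
proof -
  have "(f has_derivative (\<lambda>h. f' x * h)) (at x within {a..b})" if "a \<le> x" "x \<le> b" for x
    using assms that has_field_derivative_subset[of f "f' x" x "{0..}" "{a..b}"]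
    by (auto simp: has_field_derivative_def)
  from mvt_simple[OF \<open>a < b\<close> this] show thesis
    using that by auto
qed

text \<open>The mean value theorem for \<open>f'\<close> makes \<open>f'\<close> monotone. Applied
  to \<open>f\<close>, it gives the chord between \<open>x\<close> and \<open>y\<close> the slope of
  \<open>f\<close> at an intermediate point, which monotonicity compares with
  \<open>f' x\<close>.\<close>

lemma above_tangent_half_line:
  fixes f :: "real \<Rightarrow> real"
  assumes f': "\<And>x. x \<ge> 0 \<Longrightarrow> (f has_real_derivative f' x) (at x within {0..})"
    and f'': "\<And>x. x \<ge> 0 \<Longrightarrow> (f' has_real_derivative f'' x) (at x within {0..})"
    and nonneg: "\<And>x. x \<ge> 0 \<Longrightarrow> f'' x \<ge> 0"
    and "x \<ge> 0" "y \<ge> 0"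
  shows "f x + f' x * (y - x) \<le> f y"
proof -
  have mono: "f' a \<le> f' b" if ab: "0 \<le> a" "a < b" for a b
  proof -
    obtain z where "a < z" "z < b" "f' b - f' a = f'' z * (b - a)"
      using mvt_half_line[OF f'' ab] by blast
    moreover have "f'' z * (b - a) \<ge> 0"
      using nonneg[of z] \<open>a < z\<close> ab by simp
    ultimately show ?thesis by simp
  qed
  consider "x < y" | "x = y" | "y < x" by linarith
  then show ?thesis
  proof cases
    case 1
    obtain z where z: "x < z" "z < y" "f y - f x = f' z * (y - x)"
      using mvt_half_line[OF f' \<open>x \<ge> 0\<close> 1] by blast
    have "f' x * (y - x) \<le> f' z * (y - x)"
      using mono[OF \<open>x \<ge> 0\<close> z(1)] 1 by (intro mult_right_mono) auto
    with z(3) show ?thesis by linarith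
  next
    case 3
    obtain z where z: "y < z" "z < x" "f x - f y = f' z * (x - y)"
      using mvt_half_line[OF f' \<open>y \<ge> 0\<close> 3] by blast
    have "f' z * (x - y) \<le> f' x * (x - y)"
      using mono[of z x] z \<open>y \<ge> 0\<close> 3 by (intro mult_right_mono) auto
    with z show ?thesis by (simp add: algebra_simps)
  qed simp
qed

lemma cost_function_deriv:
  assumes "cost_function f"
  obtains f' where "\<And>x. x \<ge> 0 \<Longrightarrow> (f has_real_derivative f' x) (at x within {0..})"
    and "\<And>x. x \<ge> 0 \<Longrightarrow> f' x \<ge> 0"
    and "\<And>x y. x \<ge> 0 \<Longrightarrow> y \<ge> 0 \<Longrightarrow> f x + f' x * (y - x) \<le> f y"
proof -
  obtain f' f'' where *: "\<And>x. x \<ge> 0 \<Longrightarrow> (f has_real_derivative f' x) (at x within {0..})"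
      "\<And>x. x \<ge> 0 \<Longrightarrow> (f' has_real_derivative f'' x) (at x within {0..})"
      "\<And>x. x \<ge> 0 \<Longrightarrow> f' x \<ge> 0" "\<And>x. x \<ge> 0 \<Longrightarrow> f'' x \<ge> 0"
    using assms unfolding cost_function_def by blast
  show thesis
    by (rule that[OF *(1) *(3) above_tangent_half_line[OF *(1) *(2) *(4)]])
qed

section \<open>Compactness of the set of feasible dispatches\<close>

lemma sum_flow_zero:
  fixes Y :: "'i::finite \<Rightarrow> 'i \<Rightarrow> real"
  assumes "\<And>i j. Y i j = Y j i"
  shows "(\<Sum>i\<in>UNIV. \<Sum>j\<in>UNIV. Y i j * (t i - t j)) = 0"
proof -
  \<comment> \<open>The summand is antisymmetric in \<open>i\<close> and \<open>j\<close>, so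
    exchanging the two sums shows that the total equals its own negative.\<close>
  have "(\<Sum>i\<in>UNIV. \<Sum>j\<in>UNIV. Y i j * (t i - t j)) = (\<Sum>j\<in>UNIV. \<Sum>i\<in>UNIV. Y i j * (t i - t j))"
    by (rule sum.swap)
  also have "\<dots> = - (\<Sum>j\<in>UNIV. \<Sum>i\<in>UNIV. Y j i * (t j - t i))"
    unfolding sum_negf[symmetric] by (intro sum.cong refl) (simp add: assms algebra_simps)
  finally show ?thesis by simp
qed

text \<open>Summing the balance equations over all nodes cancels the flows. As outputs are
  nonnegative, this bounds each of them by the total demand.\<close>

lemma feasible_dispatch_total:
  assumes "connected_power_network G" "feasible_point G x \<theta>"
  shows "(\<Sum>n\<in>UNIV. x $ n) = (\<Sum>i\<in>UNIV. demand G i)"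
proof -
  have "(\<Sum>i\<in>UNIV. (\<Sum>n | location G n = i. x $ n) - demand G i) = 0"
    using assms sum_flow_zero[of "admittance G" "($) \<theta>"]
    unfolding connected_power_network_def feasible_point_def by simp
  moreover have "(\<Sum>i\<in>UNIV. \<Sum>n | location G n = i. x $ n) = (\<Sum>n\<in>UNIV. x $ n)"
    using sum.group[of UNIV UNIV "location G" "($) x"] by simp
  ultimately show ?thesis by (simp add: sum_subtractf)
qed

text \<open>Each line carries a capacity limit in both directions, which bounds the angle difference
  at its ends by capacity over admittance. These bounds add up along a path from \<open>i\<close> to
  \<open>j\<close>, which exists by connectedness.\<close>

lemma feasible_angle_bounded:
  assumes G: "connected_power_network G"
  obtains K where "\<And>x \<theta> j. feasible_point G x \<theta> \<Longrightarrow> \<bar>\<theta> $ i - \<theta> $ j\<bar> \<le> K"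
proof -
  have bd: "\<exists>K. \<forall>x \<theta>. feasible_point G x \<theta> \<longrightarrow> \<bar>\<theta> $ i - \<theta> $ j\<bar> \<le> K" for j
  proof -
    have "(i, j) \<in> (lines G)\<^sup>*"
      using G unfolding connected_power_network_def by blast
    then show ?thesis
    proof induction
      case base
      show ?case by auto
    next
      case (step j k)
      then obtain K where K: "\<And>x \<theta>. feasible_point G x \<theta> \<Longrightarrow> \<bar>\<theta> $ i - \<theta> $ j\<bar> \<le> K"
        by blast
      let ?Y = "admittance G j k" and ?C = "capacity G j k"
      have kj: "(k, j) \<in> lines G" and Y: "?Y > 0" and sym: "admittance G k j = ?Y" "capacity G k j = ?C"
        using G step.hyps(2) unfolding connected_power_network_def lines_def
        by (auto simp: less_le)
      have "\<bar>\<theta> $ i - \<theta> $ k\<bar> \<le> K + ?C / ?Y" if fp: "feasible_point G x \<theta>" for x \<theta>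
      proof -
        have "?Y * (\<theta> $ j - \<theta> $ k) \<le> ?C" "?Y * (\<theta> $ k - \<theta> $ j) \<le> ?C"
          using fp step.hyps(2) kj unfolding feasible_point_def by (auto simp flip: sym)
        then have "\<theta> $ j - \<theta> $ k \<le> ?C / ?Y" "\<theta> $ k - \<theta> $ j \<le> ?C / ?Y"
          using Y by (auto simp: field_simps)
        with K[OF fp] show ?thesis by linarith
      qed
      then show ?case by blast
    qed
  qed
  then obtain K where K: "\<And>j x \<theta>. feasible_point G x \<theta> \<Longrightarrow> \<bar>\<theta> $ i - \<theta> $ j\<bar> \<le> K j"
    by metis
  \<comment> \<open>There are finitely many nodes, so the bounds have a maximum.\<close>
  have "\<bar>\<theta> $ i - \<theta> $ j\<bar> \<le> Max (range K)" if "feasible_point G x \<theta>" for x \<theta> j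
    by (rule order_trans[OF K[OF that] Max_ge]) auto
  then show thesis by (rule that)
qed

(* The angles are determined only up to a common constant; fixing one of them to 0 makes the set of
   feasible points compact. *)
lemma compact_feasible_dispatch:
  assumes G: "connected_power_network G"
  shows "compact {x. feasible_dispatch G x}"
proof -
  fix i0
  obtain K where K: "\<And>x \<theta> j. feasible_point G x \<theta> \<Longrightarrow> \<bar>\<theta> $ i0 - \<theta> $ j\<bar> \<le> K"
    using feasible_angle_bounded[OF G] by blast
  define S where "S = {(x, \<theta>). feasible_point G x \<theta> \<and> \<theta> $ i0 = 0}"
  \<comment> \<open>Every constraint is an equation or a weak inequality between continuous
    functions; being a line does not depend on the point.\<close>
  have "closed S"
    unfolding S_def feasible_point_def case_prod_unfold Ball_def
    by (intro closed_Collect_conj closed_Collect_all closed_Collect_imp closed_Collect_eq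
        closed_Collect_le open_Collect_const continuous_intros)
  moreover have "bounded S"
  proof (rule bounded_subset)
    let ?D = "\<Sum>i\<in>UNIV. demand G i"
    show "bounded (cbox (0 :: real ^ 'b) (\<chi> n. ?D) \<times> cbox (\<chi> i. - K) (\<chi> i. K))"
      by (intro bounded_Times bounded_cbox)
    have "x \<in> cbox 0 (\<chi> n. ?D) \<and> \<theta> \<in> cbox (\<chi> i. - K) (\<chi> i. K)"
      if fp: "feasible_point G x \<theta>" and "\<theta> $ i0 = 0" for x \<theta>
    proof -
      have nonneg: "x $ n \<ge> 0" for n
        using fp unfolding feasible_point_def by blast
      have "x $ n \<le> ?D" for n
        using member_le_sum[of n UNIV "($) x"] nonneg feasible_dispatch_total[OF G fp] by simp
      moreover have "- K \<le> \<theta> $ j \<and> \<theta> $ j \<le> K" for j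
        using K[OF fp, of j] that(2) by linarith
      ultimately show ?thesis
        using nonneg by (simp add: mem_box_cart)
    qed
    then show "S \<subseteq> cbox 0 (\<chi> n. ?D) \<times> cbox (\<chi> i. - K) (\<chi> i. K)"
      unfolding S_def by blast
  qed
  ultimately have "compact (fst ` S)"
    by (intro compact_continuous_image continuous_intros) (simp add: compact_eq_bounded_closed)
  moreover have "fst ` S = {x. feasible_dispatch G x}"
  proof -
    \<comment> \<open>The constraints involve only differences of angles, so subtracting the angle
      at \<open>i0\<close> everywhere preserves feasibility.\<close>
    have "x \<in> fst ` S" if "feasible_point G x \<theta>" for x \<theta>
    proof (rule image_eqI)
      show "(x, \<chi> i. \<theta> $ i - \<theta> $ i0) \<in> S"
        using that unfolding S_def feasible_point_def by simp
    qed simp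
    then show ?thesis
      unfolding feasible_dispatch_def by (auto simp: S_def)
  qed
  ultimately show ?thesis by simp
qed

section \<open>Existence of optimal dispatches and the first-order condition\<close>

lemma feasible_dispatch_nonneg: "feasible_dispatch G x \<Longrightarrow> x $ n \<ge> 0"
  unfolding feasible_dispatch_def feasible_point_def by blast

lemma feasible_dispatch_convex:
  assumes "feasible_dispatch G x" "feasible_dispatch G y" and t: "0 \<le> t" "t \<le> (1::real)"
  shows "feasible_dispatch G (x + t *\<^sub>R (y - x))"
proof -
  obtain \<theta> \<phi> where fp: "feasible_point G x \<theta>" "feasible_point G y \<phi>"
    using assms unfolding feasible_dispatch_def by blast
  \<comment> \<open>All constraints are affine in outputs and angles jointly, so the angles are
    combined with the same weight \<open>t\<close> as the outputs.\<close>
  let ?\<psi> = "\<theta> + t *\<^sub>R (\<phi> - \<theta>)"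
  have comb: "(x + t *\<^sub>R (y - x)) $ n = (1 - t) * x $ n + t * y $ n" for n
    by (simp add: algebra_simps)
  have flow: "admittance G i j * (?\<psi> $ i - ?\<psi> $ j) =
      (1 - t) * (admittance G i j * (\<theta> $ i - \<theta> $ j)) + t * (admittance G i j * (\<phi> $ i - \<phi> $ j))"
    for i j
    by (simp add: algebra_simps)
  have "feasible_point G (x + t *\<^sub>R (y - x)) ?\<psi>"
    unfolding feasible_point_def
  proof (intro conjI allI ballI, goal_cases)
    case (1 i)
    have "(\<Sum>n | location G n = i. (x + t *\<^sub>R (y - x)) $ n) - demand G i =
      (1 - t) * ((\<Sum>n | location G n = i. x $ n) - demand G i) +
      t * ((\<Sum>n | location G n = i. y $ n) - demand G i)"
      unfolding comb sum.distrib sum_distrib_left[symmetric] by (simp add: algebra_simps)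
    then show ?case
      using fp unfolding feasible_point_def flow sum.distrib sum_distrib_left[symmetric] by simp
  next
    case (2 e)
    obtain i j where e: "e = (i, j)" by (cases e)
    have "(1 - t) * (admittance G i j * (\<theta> $ i - \<theta> $ j)) +
        t * (admittance G i j * (\<phi> $ i - \<phi> $ j)) \<le> capacity G i j"
      using fp 2 t e unfolding feasible_point_def by (intro convex_bound_le) auto
    then show ?case
      unfolding e flow by simp
  next
    case (3 n)
    show ?case
      using fp t unfolding feasible_point_def comb by simp
  qed
  then show ?thesis
    unfolding feasible_dispatch_def by blast
qed

lemma economic_dispatch_exists:
  assumes "connected_power_network G" "\<And>n. continuous_on {0..} (f n)" "feasible_dispatch G y"
  obtains x where "economic_dispatch G f x"
proof -
  have "continuous_on {x. feasible_dispatch G x} (\<lambda>x. f n (x $ n))" for n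
    by (rule continuous_on_compose2[OF assms(2)])
      (auto intro!: continuous_intros simp: feasible_dispatch_nonneg)
  then have "continuous_on {x. feasible_dispatch G x} (total_cost f)"
    unfolding total_cost_def by (intro continuous_intros)
  then obtain x where "feasible_dispatch G x" "\<And>y. feasible_dispatch G y \<Longrightarrow> total_cost f x \<le> total_cost f y"
    using continuous_attains_inf[OF compact_feasible_dispatch[OF assms(1)]] assms(3) by blast
  then show thesis
    using that unfolding economic_dispatch_def is_arg_min_linorder by blast
qed

text \<open>If the linearized cost were smaller at \<open>y\<close> than at \<open>x\<close>, a
  short move from \<open>x\<close> towards \<open>y\<close>, feasible by convexity, would lower the
  cost itself.\<close>

lemma economic_dispatch_first_order:
  assumes opt: "economic_dispatch G f x" and y: "feasible_dispatch G y"
    and deriv: "\<And>n. (f n has_real_derivative d n) (at (x $ n) within {0..})"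
  shows "(\<Sum>n\<in>UNIV. d n * x $ n) \<le> (\<Sum>n\<in>UNIV. d n * y $ n)"
proof (rule ccontr)
  assume "\<not> ?thesis"
  then have neg: "(\<Sum>n\<in>UNIV. d n * (y $ n - x $ n)) < 0"
    by (simp add: right_diff_distrib sum_subtractf)
  have x: "feasible_dispatch G x"
    using opt unfolding economic_dispatch_def is_arg_min_def by blast
  define z where "z t = x + t *\<^sub>R (y - x)" for t
  have z: "feasible_dispatch G (z t)" if "t \<in> {0..1}" for t
    using that feasible_dispatch_convex[OF x y] unfolding z_def by simp
  have "((\<lambda>t. f n (z t $ n)) has_real_derivative d n * (y $ n - x $ n)) (at 0 within {0..1})" for n
  proof -
    have "((\<lambda>t. z t $ n) has_real_derivative y $ n - x $ n) (at 0 within {0..1})"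
      unfolding z_def by (auto intro!: derivative_eq_intros)
    \<comment> \<open>The derivative may be one-sided, so the chain rule needs the segment to keep
      every output nonnegative.\<close>
    moreover have "(f n has_real_derivative d n) (at (z 0 $ n) within (\<lambda>t. z t $ n) ` {0..1})"
    proof (rule has_field_derivative_subset)
      show "(f n has_real_derivative d n) (at (z 0 $ n) within {0..})"
        using deriv[of n] by (simp add: z_def)
      show "(\<lambda>t. z t $ n) ` {0..1} \<subseteq> {0..}"
        using feasible_dispatch_nonneg[OF z] by blast
    qed
    ultimately show ?thesis
      using DERIV_image_chain[of "f n" "d n" "\<lambda>t. z t $ n"] by (simp add: o_def)
  qed
  then have "((\<lambda>t. total_cost f (z t)) has_real_derivative (\<Sum>n\<in>UNIV. d n * (y $ n - x $ n)))
      (at 0 within {0..1})"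
    unfolding total_cost_def by (intro DERIV_sum) auto
  from has_real_derivative_neg_dec_right[OF this neg] obtain e where e: "e > 0"
    "\<And>h. h > 0 \<Longrightarrow> h \<in> {0..1} \<Longrightarrow> h < e \<Longrightarrow> total_cost f (z h) < total_cost f (z 0)"
    by auto
  \<comment> \<open>This step length is positive, below \<open>e\<close> and within the
    segment.\<close>
  have "total_cost f (z (min 1 (e / 2))) < total_cost f (z 0)"
    using e(1) by (intro e(2)) auto
  moreover have "feasible_dispatch G (z (min 1 (e / 2)))"
    using e(1) by (intro z) auto
  ultimately show False
    using opt unfolding economic_dispatch_def is_arg_min_def by (auto simp: z_def)
qed

section \<open>Dependence of the payoff on the own bid\<close>

lemma excluded_dispatch_own_bid:
  assumes "valid_bid \<beta>" "valid_bid (b m)"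
  shows "excluded_dispatch G (b(m := \<beta>)) m = excluded_dispatch G b m"
proof -
  \<comment> \<open>Every valid bid vanishes at 0, so the bid of \<open>m\<close> is invisible when
    \<open>m\<close> is excluded. Both problems have the same solutions, and \<open>SOME\<close>
    selects the same one.\<close>
  have "total_cost (\<lambda>n. bid_fun ((b(m := \<beta>)) n)) z = total_cost (\<lambda>n. bid_fun (b n)) z"
    if "z $ m = 0" for z
    unfolding total_cost_def using that assms by (intro sum.cong) (auto simp: bid_fun_0)
  then show ?thesis
    unfolding excluded_dispatch_def economic_dispatch_excluding_def is_arg_min_def
    by (metis (no_types, lifting))
qed

text \<open>The second-price structure: the first sum depends neither on \<open>\<beta>\<close> nor
  on \<open>x\<close>, and what is subtracted is the cost of \<open>x\<close> with the bid of
  \<open>m\<close> replaced by \<open>c m\<close>. A deviation thus matters only through the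
  dispatch it induces.\<close>

lemma payoff_own_bid:
  assumes "valid_bid \<beta>" "valid_bid (b m)"
  shows "payoff G c (b(m := \<beta>)) x m =
    (\<Sum>n\<in>UNIV - {m}. bid_fun (b n) (excluded_dispatch G b m $ n)) -
    ((\<Sum>n\<in>UNIV - {m}. bid_fun (b n) (x $ n)) + c m (x $ m))"
proof -
  have "(\<Sum>n\<in>UNIV - {m}. bid_fun ((b(m := \<beta>)) n) (v $ n)) = (\<Sum>n\<in>UNIV - {m}. bid_fun (b n) (v $ n))"
    for v :: "real ^ 'a"
    by (intro sum.cong) auto
  then show ?thesis
    unfolding payoff_def payment_def excluded_dispatch_own_bid[of \<beta> b m G, OF assms] by simp
qed

section \<open>Construction of the equilibrium\<close>

theorem theorem3:
  fixes G :: "('i::finite, 'n::finite) power_network"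
    and c :: "'n \<Rightarrow> real \<Rightarrow> real"
  assumes "connected_power_network G"
    and "\<And>n. cost_function (c n)"
    and "\<And>m. \<exists>x \<theta>. feasible_point G x \<theta> \<and> x $ m = 0"
  shows "\<exists>b x. efficient_nash_equilibrium G c b x"
proof -
  have "\<exists>c'. \<forall>x\<ge>0. (c n has_real_derivative c' x) (at x within {0..}) \<and> c' x \<ge> 0 \<and>
      (\<forall>y\<ge>0. c n x + c' x * (y - x) \<le> c n y)" for n
    by (rule cost_function_deriv[OF assms(2)[of n]]) blast
  then obtain c' where
      deriv: "\<And>n x. x \<ge> 0 \<Longrightarrow> (c n has_real_derivative c' n x) (at x within {0..})"
    and nonneg: "\<And>n x. x \<ge> 0 \<Longrightarrow> c' n x \<ge> 0"
    and tangent: "\<And>n x y. x \<ge> 0 \<Longrightarrow> y \<ge> 0 \<Longrightarrow> c n x + c' n x * (y - x) \<le> c n y"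
    by metis
  have "continuous_on {0..} (c n)" for n
    using deriv by (intro DERIV_continuous_on) auto
  moreover obtain y0 where "feasible_dispatch G y0"
    using assms(3) unfolding feasible_dispatch_def by blast
  ultimately obtain x where opt: "economic_dispatch G c x"
    using economic_dispatch_exists[OF assms(1)] by blast
  then have x: "feasible_dispatch G x"
    unfolding economic_dispatch_def is_arg_min_def by blast
  note x0 = feasible_dispatch_nonneg[OF x]
  \<comment> \<open>Equal prices make the bid linear through the origin, so the breakpoint 0 has no
    effect on its values.\<close>
  define b where "b n = (c' n (x $ n), 0::real, c' n (x $ n))" for n
  have bid: "bid_fun (b n) = (\<lambda>t. c' n (x $ n) * t)" for n
    by (auto simp: b_def bid_fun_def)
  have valid: "valid_bid (b n)" for n
    using nonneg[OF x0] by (simp add: b_def valid_bid_def)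
  \<comment> \<open>The bids are linear with the marginal costs at \<open>x\<close> as slopes, so
    this is exactly the first-order condition.\<close>
  have min: "(\<Sum>n\<in>UNIV. bid_fun (b n) (x $ n)) \<le> (\<Sum>n\<in>UNIV. bid_fun (b n) (y $ n))"
    if "feasible_dispatch G y" for y
    using economic_dispatch_first_order[OF opt that deriv[OF x0]] unfolding bid .
  have dispatch: "pnsp_dispatch G b x"
    using x min unfolding pnsp_dispatch_def economic_dispatch_def is_arg_min_linorder total_cost_def
    by blast
  have "payoff G c (b(m := \<beta>)) x' m \<le> payoff G c b x m"
    if \<beta>: "valid_bid \<beta>" and x': "pnsp_dispatch G (b(m := \<beta>)) x'" for m \<beta> x'
  proof -
    have fd: "feasible_dispatch G x'"
      using x' unfolding pnsp_dispatch_def economic_dispatch_def is_arg_min_def by blast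
    \<comment> \<open>Between \<open>x\<close> and \<open>x'\<close> the true cost of
      \<open>m\<close> rises at least as much as his linear bid, by the tangent inequality. Adding
      the optimality of \<open>x\<close> for the bids gives optimality of \<open>x\<close> with
      \<open>c m\<close> in place of the bid of \<open>m\<close>.\<close>
    have "c m (x $ m) + (bid_fun (b m) (x' $ m) - bid_fun (b m) (x $ m)) \<le> c m (x' $ m)"
      using tangent[OF x0 feasible_dispatch_nonneg[OF fd], of m m m]
      by (simp add: bid right_diff_distrib)
    moreover have "(\<Sum>n\<in>UNIV - {m}. bid_fun (b n) (x $ n)) + bid_fun (b m) (x $ m) \<le>
        (\<Sum>n\<in>UNIV - {m}. bid_fun (b n) (x' $ n)) + bid_fun (b m) (x' $ m)"
      using min[OF fd] by (simp add: sum.remove[of UNIV m] add.commute)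
    ultimately show ?thesis
      \<comment> \<open>The instance with \<open>b m\<close> itself as the new bid yields the payoff
        in the equilibrium.\<close>
      using payoff_own_bid[of \<beta> b m G c x'] payoff_own_bid[of "b m" b m G c x] \<beta> valid by simp
  qed
  then have "nash_equilibrium G c b x"
    using valid dispatch unfolding nash_equilibrium_def by blast
  then show ?thesis
    using opt unfolding efficient_nash_equilibrium_def by blast
qed

end
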